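(* There is a set $\mathcal A$ of positive integers of asymptotic density $0$ satisfying $$\sum_{a\in\mathcal A\setminus\{1\}}\frac1{a\log a}<\infty \quad\text{and}\quad \sum_{a\in\mathcal A}\frac1a=\infty,$$ such that for any primitive set $\mathcal S$ contained in $\mathcal A$ we have $$\sum_{s\in\mathcal S}\frac1s<\infty.$$
   Context: A set of positive integers is primitive if no element of the set is a multiple of another (distinct) element of the set. A set $\mathcal A$ of positive integers has asymptotic density $0$ if $\#\{a\in\mathcal A\colon a\le x\}/x\to0$ as $x\to\infty$. *)

theory Defs
  imports "HOL-Analysis.Analysis"
begin

definition primitive_set :: "nat set \<Rightarrow> bool" where
  "primitive_set S \<longleftrightarrow>
     (\<forall>s\<in>S. 0 < s) \<and> (\<forall>s\<in>S. \<forall>t\<in>S. s \<noteq> t \<longrightarrow> \<not> s dvd t)"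

definition asymptotic_density_zero :: "nat set \<Rightarrow> bool" where
  "asymptotic_density_zero A \<longleftrightarrow>
     ((\<lambda>x::real. real (card {a \<in> A. real a \<le> x}) / x) \<longlongrightarrow> 0) at_top"

end

(* Let A be the union of finite blocks B k, where B k consists of large multiples of k! whose
   reciprocals have a sum between 1 and 2. A positive s divides every element of B k for all
   k \<ge> s, so a primitive subset of A meets only finitely many blocks and is therefore finite.
   The sum of the 1/a diverges since every block contributes at least 1. Taking
   ln a \<ge> 2^k on B k makes the sum of the 1/(a ln a) at most the sum of the 2/2^k. Finally,
   all but finitely many elements of A are multiples of K!, whence the density is 0. *)

theory Submission
  imports Defs
begin

text \<open>The reciprocals of the multiples of \<open>d\<close> have a divergent sum, even when
  started beyond \<open>x\<close>. Consecutive multiples are collected until the sum first reaches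
  1; the last one adds at most 1, so the total stays below 2.\<close>

lemma multiples_block_exists:
  fixes d :: nat and x :: real
  assumes "0 < d"
  obtains B where "finite B" "\<And>b. b \<in> B \<Longrightarrow> d dvd b" "\<And>b. b \<in> B \<Longrightarrow> x \<le> real b"
    "1 \<le> (\<Sum>b\<in>B. 1 / real b)" "(\<Sum>b\<in>B. 1 / real b) \<le> 2"
proof -
  \<comment> \<open>The \<open>Suc\<close> keeps \<open>N\<close> positive even for
    \<open>x \<le> 0\<close>, so that no \<open>h i\<close> is 0.\<close>
  define N where "N = Suc (nat \<lceil>x\<rceil>)"
  define h where "h n = d * (n + N)" for n
  define P where "P n \<longleftrightarrow> 1 \<le> (\<Sum>i<n. 1 / real (h i))" for n
  have "\<not> summable (\<lambda>n. 1 / real (h n))"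
  proof
    assume "summable (\<lambda>n. 1 / real (h n))"
    \<comment> \<open>Clearing the factor \<open>d\<close> leaves a tail of the harmonic
      series.\<close>
    then have "summable (\<lambda>n. real d * (1 / real (h n)))"
      by (rule summable_mult)
    moreover have "real d * (1 / real (h n)) = inverse (real (n + N))" for n
      using assms by (simp add: h_def inverse_eq_divide)
    ultimately have "summable (\<lambda>n. inverse (real (n + N)))"
      by simp
    then show False
      using not_summable_harmonic[where ?'a = real]
        summable_iff_shift[of "\<lambda>n. inverse (real n)" N] by simp
  qed
  have "\<exists>n. P n"
  proof (rule ccontr)
    assume "\<nexists>n. P n"
    then have "(\<Sum>i\<le>n. 1 / real (h i)) \<le> 1" for n
      unfolding P_def lessThan_Suc_atMost[symmetric] by (meson linear)
    then have "summable (\<lambda>n. 1 / real (h n))"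
      by (intro bounded_imp_summable) auto
    with \<open>\<not> summable (\<lambda>n. 1 / real (h n))\<close> show False
      by contradiction
  qed
  define n where "n = (LEAST n. P n)"
  have "P n"
    unfolding n_def using \<open>\<exists>n. P n\<close> by (rule LeastI_ex)
  \<comment> \<open>The empty sum is below 1, so \<open>n\<close> is not 0 and a last term can be
    split off.\<close>
  then obtain m where m: "n = Suc m"
    by (cases n) (auto simp: P_def)
  have "\<not> P m"
    using m not_less_Least[of m P] by (simp add: n_def)
  have pos: "1 \<le> h i" for i
    using assms by (simp add: h_def N_def)
  have "1 / real (h m) \<le> 1"
    using pos[of m] by (simp add: divide_le_eq_1)
  with \<open>\<not> P m\<close> have upper: "(\<Sum>i<n. 1 / real (h i)) \<le> 2"
    by (simp add: P_def m)
  have "inj_on h {..<n}"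
    using assms by (auto simp: h_def inj_on_def)
  then have sum_eq: "(\<Sum>b\<in>h ` {..<n}. 1 / real b) = (\<Sum>i<n. 1 / real (h i))"
    by (simp add: sum.reindex)
  have "x \<le> real (h i)" for i
  proof -
    have "i + N \<le> h i"
      using assms by (simp add: h_def)
    then have "real N \<le> real (h i)"
      by linarith
    then show ?thesis
      unfolding N_def by linarith
  qed
  then show thesis
    using \<open>P n\<close> upper sum_eq
    by (intro that[of "h ` {..<n}"]) (auto simp: P_def h_def)
qed

text \<open>This is the Cauchy criterion: past some finite \<open>F\<close> all finite sums lie
  within 1/2 of the limit, hence differ by less than 1, but adjoining a block disjoint from
  \<open>F\<close> adds at least 1.\<close>

lemma not_summable_on_if_blocks:
  fixes f :: "'a \<Rightarrow> real"
  assumes "\<And>F. finite F \<Longrightarrow> F \<subseteq> A \<Longrightarrow> \<exists>B. finite B \<and> B \<subseteq> A \<and> B \<inter> F = {} \<and> 1 \<le> sum f B"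
  shows "\<not> f summable_on A"
proof
  assume "f summable_on A"
  then obtain s where "(sum f \<longlongrightarrow> s) (finite_subsets_at_top A)"
    by (auto simp: summable_on_def has_sum_def)
  then have "\<forall>\<^sub>F Y in finite_subsets_at_top A. dist (sum f Y) s < 1/2"
    by (rule tendstoD) simp
  then obtain F where F: "finite F" "F \<subseteq> A"
    and close: "\<And>Y. finite Y \<Longrightarrow> F \<subseteq> Y \<Longrightarrow> Y \<subseteq> A \<Longrightarrow> dist (sum f Y) s < 1/2"
    by (auto simp: eventually_finite_subsets_at_top)
  obtain B where B: "finite B" "B \<subseteq> A" "B \<inter> F = {}" "1 \<le> sum f B"
    using assms[OF F] by metis
  have "sum f (B \<union> F) = sum f B + sum f F"
    using B F by (simp add: sum.union_disjoint)
  moreover have "dist (sum f (B \<union> F)) s < 1/2" "dist (sum f F) s < 1/2"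
    using B F by (intro close; blast)+
  ultimately show False
    using B(4) unfolding dist_real_def by linarith
qed

text \<open>The sets may overlap: a shared element is counted repeatedly on the right, which only
  helps since \<open>f\<close> is nonnegative.\<close>

lemma sum_UNION_le:
  fixes f :: "'a \<Rightarrow> real"
  assumes "finite I" "\<And>i. i \<in> I \<Longrightarrow> finite (B i)" "\<And>a. 0 \<le> f a"
  shows "sum f (\<Union>i\<in>I. B i) \<le> (\<Sum>i\<in>I. sum f (B i))"
  using assms(1,2)
proof (induction rule: finite_induct)
  case (insert i I)
  let ?U = "\<Union>i\<in>I. B i"
  have "sum f (B i \<union> ?U) + sum f (B i \<inter> ?U) = sum f (B i) + sum f ?U"
    using insert by (intro sum.union_inter) auto
  moreover have "0 \<le> sum f (B i \<inter> ?U)"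
    using assms(3) by (rule sum_nonneg)
  moreover have "sum f ?U \<le> (\<Sum>i\<in>I. sum f (B i))"
    using insert by blast
  ultimately show ?case
    using insert by simp
qed simp

text \<open>The elements are \<open>d * q\<close> with \<open>1 \<le> q \<le> x / d\<close>.
  Finiteness is stated separately because \<open>card\<close> is 0 on infinite sets.\<close>

lemma card_multiples_le:
  fixes x :: real
  assumes "0 < d" "0 \<le> x"
  shows "finite {a::nat. 0 < a \<and> d dvd a \<and> real a \<le> x}"
    and "real (card {a::nat. 0 < a \<and> d dvd a \<and> real a \<le> x}) \<le> x / real d"
proof -
  let ?n = "nat \<lfloor>x / real d\<rfloor>"
  have sub: "{a::nat. 0 < a \<and> d dvd a \<and> real a \<le> x} \<subseteq> (*) d ` {1..?n}"
  proof
    fix a assume "a \<in> {a::nat. 0 < a \<and> d dvd a \<and> real a \<le> x}"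
    then obtain q where q: "a = d * q" "0 < q" "real d * real q \<le> x"
      by (auto elim!: dvdE)
    then have "real q \<le> x / real d"
      using assms by (simp add: field_simps)
    then have "q \<le> ?n"
      by linarith
    with q show "a \<in> (*) d ` {1..?n}"
      by (intro image_eqI[of _ _ q]) auto
  qed
  then show "finite {a::nat. 0 < a \<and> d dvd a \<and> real a \<le> x}"
    by (rule finite_subset) simp
  have "card {a::nat. 0 < a \<and> d dvd a \<and> real a \<le> x} \<le> ?n"
    using surj_card_le[OF _ sub] by simp
  moreover have "real ?n \<le> x / real d"
    using assms by simp
  ultimately show "real (card {a::nat. 0 < a \<and> d dvd a \<and> real a \<le> x}) \<le> x / real d"
    by linarith
qed

text \<open>Up to a finite set, \<open>A\<close> consists of multiples of \<open>d\<close>, so its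
  upper density is at most \<open>1 / d\<close>, with \<open>d\<close> arbitrarily large.\<close>

lemma asymptotic_density_zeroI:
  assumes pos: "\<And>a. a \<in> A \<Longrightarrow> 0 < a"
    and cofinite: "\<And>K. \<exists>d\<ge>Suc K. finite {a \<in> A. \<not> d dvd a}"
  shows "asymptotic_density_zero A"
  unfolding asymptotic_density_zero_def
proof (rule tendstoI)
  fix e :: real
  assume "0 < e"
  \<comment> \<open>One half of \<open>e\<close> is for the multiples of \<open>d\<close>, the other
    for the finite exceptional set, whose share drops below \<open>e / 2\<close> once
    \<open>x\<close> is large.\<close>
  obtain K where K: "inverse (real (Suc K)) < e / 2"
    using reals_Archimedean[of "e / 2"] \<open>0 < e\<close> by auto
  obtain d where d: "Suc K \<le> d" "finite {a \<in> A. \<not> d dvd a}"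
    using cofinite by blast
  define E where "E = {a \<in> A. \<not> d dvd a}"
  have "1 / real d \<le> inverse (real (Suc K))"
    using d(1) by (simp add: inverse_eq_divide frac_le)
  with K have d_small: "1 / real d < e / 2"
    by linarith
  have bound: "dist (real (card {a \<in> A. real a \<le> x}) / x) 0 < e"
    if x: "0 < x" "2 * real (card E) / e < x" for x :: real
  proof -
    let ?M = "{a::nat. 0 < a \<and> d dvd a \<and> real a \<le> x}"
    have M: "finite ?M" "real (card ?M) \<le> x / real d"
      using card_multiples_le[of d x] d(1) x(1) by auto
    have "{a \<in> A. real a \<le> x} \<subseteq> E \<union> ?M"
      using pos by (auto simp: E_def)
    then have "card {a \<in> A. real a \<le> x} \<le> card (E \<union> ?M)"
      using d(2) M(1) by (intro card_mono) (auto simp: E_def)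
    also have "\<dots> \<le> card E + card ?M"
      by (rule card_Un_le)
    finally have "real (card {a \<in> A. real a \<le> x}) \<le> real (card E) + x / real d"
      using M(2) by linarith
    moreover have "real (card E) < x * (e / 2)"
      using x \<open>0 < e\<close> by (simp add: field_simps)
    moreover have "x / real d \<le> x * (e / 2)"
      using mult_left_mono[of "1 / real d" "e / 2" x] d_small x(1) by simp
    moreover have "x * e = x * (e / 2) + x * (e / 2)"
      by simp
    ultimately have "real (card {a \<in> A. real a \<le> x}) < x * e"
      by linarith
    then show ?thesis
      using x(1) by (simp add: field_simps)
  qed
  show "\<forall>\<^sub>F x in at_top. dist (real (card {a \<in> A. real a \<le> x}) / x) 0 < e"
    using eventually_gt_at_top[of 0] eventually_gt_at_top[of "2 * real (card E) / e"]
    by eventually_elim (rule bound)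
qed

theorem theorem2:
  shows "\<exists>A :: nat set.
    (\<forall>a\<in>A. 0 < a) \<and>
    asymptotic_density_zero A \<and>
    (\<lambda>a. 1 / (real a * ln (real a))) summable_on (A - {1}) \<and>
    \<not> (\<lambda>a. 1 / real a) summable_on A \<and>
    (\<forall>S. S \<subseteq> A \<and> primitive_set S \<longrightarrow> (\<lambda>s. 1 / real s) summable_on S)"
proof -
  have "\<exists>B. finite B \<and> (\<forall>b\<in>B. fact k dvd b) \<and> (\<forall>b\<in>B. exp (2 ^ k) \<le> real b) \<and>
      1 \<le> (\<Sum>b\<in>B. 1 / real b) \<and> (\<Sum>b\<in>B. 1 / real b) \<le> 2" for k
  proof -
    have "(0::nat) < fact k"
      by simp
    then show ?thesis
      by (rule multiples_block_exists[of _ "exp (2 ^ k)"]) blast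
  qed
  then obtain B where fin: "\<And>k. finite (B k)" and dvd: "\<And>k b. b \<in> B k \<Longrightarrow> fact k dvd b"
    and large: "\<And>k b. b \<in> B k \<Longrightarrow> exp (2 ^ k) \<le> real b"
    and lower: "\<And>k. 1 \<le> (\<Sum>b\<in>B k. 1 / real b)"
    and upper: "\<And>k. (\<Sum>b\<in>B k. 1 / real b) \<le> 2"
    by metis
  define A where "A = (\<Union>k. B k)"
  \<comment> \<open>The size bound also drives the blocks to infinity: a number \<open>b\<close> can
    lie only in blocks of index below \<open>b\<close>.\<close>
  have gt: "k < b" if "b \<in> B k" for k b
  proof -
    have "real k < 2 ^ k"
      by (rule of_nat_less_two_power)
    also have "\<dots> < exp (2 ^ k)"
      using exp_ge_add_one_self[of "2 ^ k"] by linarith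
    also have "\<dots> \<le> real b"
      using that by (rule large)
    finally show ?thesis
      by simp
  qed
  have pos: "0 < a" if "a \<in> A" for a
    using that gt by (fastforce simp: A_def)
  \<comment> \<open>From index \<open>d\<close> on, \<open>d\<close> divides \<open>fact k\<close>
    and so the whole block. Both the density and the claim on primitive sets rest on this.\<close>
  have cofinite: "finite {a \<in> A. \<not> d dvd a}" if "0 < d" for d
  proof (rule finite_subset)
    show "{a \<in> A. \<not> d dvd a} \<subseteq> (\<Union>k<d. B k)"
    proof
      fix a assume a: "a \<in> {a \<in> A. \<not> d dvd a}"
      then obtain k where k: "a \<in> B k"
        by (auto simp: A_def)
      have "k < d"
      proof (rule ccontr)
        assume "\<not> k < d"
        then have "d dvd fact k"
          using that by (intro dvd_fact) auto
        with dvd[OF k] a show False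
          by (auto dest: dvd_trans)
      qed
      with k show "a \<in> (\<Union>k<d. B k)"
        by blast
    qed
  qed (simp add: fin)
  have "asymptotic_density_zero A"
    using pos cofinite by (intro asymptotic_density_zeroI) auto
  moreover have "(\<lambda>a. 1 / (real a * ln (real a))) summable_on (A - {1})"
  proof (rule nonneg_bdd_above_summable_on)
    let ?f = "\<lambda>a::nat. 1 / (real a * ln (real a))"
    \<comment> \<open>At 0 and 1 the denominator vanishes, and division by 0 yields 0.\<close>
    have nonneg: "0 \<le> ?f a" for a
      by (cases "a = 0") auto
    then show "\<And>a. a \<in> A - {1} \<Longrightarrow> 0 \<le> ?f a"
      by blast
    have block: "sum ?f (B k) \<le> 2 * (1 / 2) ^ k" for k
    proof -
      have "?f b \<le> (1 / 2) ^ k * (1 / real b)" if "b \<in> B k" for b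
      proof -
        have "0 < real b"
          using gt[OF that] by simp
        then have "2 ^ k \<le> ln (real b)"
          using large[OF that] by (simp add: ln_ge_iff)
        then have "1 / ln (real b) \<le> 1 / 2 ^ k"
          by (intro frac_le) auto
        then have "1 / ln (real b) * (1 / real b) \<le> (1 / 2) ^ k * (1 / real b)"
          unfolding power_one_over by (rule mult_right_mono) simp
        then show ?thesis
          by (simp add: mult.commute)
      qed
      then have "sum ?f (B k) \<le> (\<Sum>b\<in>B k. (1 / 2) ^ k * (1 / real b))"
        by (rule sum_mono)
      also have "\<dots> = (1 / 2) ^ k * (\<Sum>b\<in>B k. 1 / real b)"
        by (simp only: sum_distrib_left)
      also have "\<dots> \<le> (1 / 2) ^ k * 2"
        using upper by (intro mult_left_mono) auto
      finally show ?thesis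
        by simp
    qed
    have "sum ?f F \<le> 4" if F: "F \<subseteq> A - {1}" "finite F" for F
    proof -
      \<comment> \<open>Blocks of index at least \<open>n\<close> have only elements beyond
        \<open>Max F\<close>; inserting 0 covers empty \<open>F\<close>.\<close>
      define n where "n = Suc (Max (insert 0 F))"
      have "F \<subseteq> (\<Union>k<n. B k)"
      proof
        fix a assume "a \<in> F"
        then obtain k where k: "a \<in> B k"
          using F by (auto simp: A_def)
        have "a \<le> Max (insert 0 F)"
          using \<open>a \<in> F\<close> F by (intro Max_ge) auto
        with gt[OF k] have "k < n"
          by (simp add: n_def)
        with k show "a \<in> (\<Union>k<n. B k)"
          by blast
      qed
      then have "sum ?f F \<le> sum ?f (\<Union>k<n. B k)"
        using nonneg fin by (intro sum_mono2) auto
      also have "\<dots> \<le> (\<Sum>k<n. sum ?f (B k))"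
        using nonneg fin by (intro sum_UNION_le) auto
      also have "\<dots> \<le> (\<Sum>k<n. 2 * (1 / 2) ^ k)"
        using block by (rule sum_mono)
      also have "\<dots> = 2 * (\<Sum>k<n. (1 / 2) ^ k)"
        by (simp only: sum_distrib_left)
      also have "\<dots> \<le> 4"
        by (simp add: sum_gp_strict)
      finally show ?thesis .
    qed
    then show "bdd_above (sum ?f ` {F. F \<subseteq> A - {1} \<and> finite F})"
      by (intro bdd_aboveI[of _ 4]) auto
  qed
  moreover have "\<not> (\<lambda>a. 1 / real a) summable_on A"
  proof (rule not_summable_on_if_blocks)
    fix F assume F: "finite F" "F \<subseteq> A"
    \<comment> \<open>Every element of a block exceeds its index, here the maximum of
      \<open>F\<close>.\<close>
    have "B (Max (insert 0 F)) \<inter> F = {}"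
    proof -
      have "b \<notin> F" if "b \<in> B (Max (insert 0 F))" for b
        using gt[OF that] Max_ge[of "insert 0 F" b] F(1) by auto
      then show ?thesis
        by blast
    qed
    moreover have "B (Max (insert 0 F)) \<subseteq> A"
      by (auto simp: A_def)
    ultimately show "\<exists>B. finite B \<and> B \<subseteq> A \<and> B \<inter> F = {} \<and> 1 \<le> (\<Sum>a\<in>B. 1 / real a)"
      using fin lower by (intro exI[of _ "B (Max (insert 0 F))"]) simp
  qed
  moreover have "(\<lambda>s. 1 / real s) summable_on S" if S: "S \<subseteq> A" "primitive_set S" for S
  proof -
    have "finite S"
    proof (cases "S = {}")
      case False
      then obtain s where s: "s \<in> S"
        by blast
      \<comment> \<open>By primitivity \<open>s\<close> divides no other element of
        \<open>S\<close>, so \<open>cofinite\<close> with \<open>d = s\<close> makes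
        \<open>S\<close> finite.\<close>
      have "S \<subseteq> insert s {a \<in> A. \<not> s dvd a}"
        using S s by (auto simp: primitive_set_def)
      moreover have "0 < s"
        using S(1) s pos by blast
      ultimately show ?thesis
        using cofinite by (meson finite_insert finite_subset)
    qed simp
    then show ?thesis
      by (rule summable_on_finite)
  qed
  ultimately show ?thesis
    using pos by (intro exI[of _ A] conjI ballI allI impI) simp_all
qed

end
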